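(* Let $E$ be a Banach space, let $0\le r\le\infty$, let $I=I^r$, and let $H\subset\mathrm{Map}(I^r,E)$ be a history space. If $\boldsymbol 0$ is closed under $C^1$-prolongations with $0$-derivative in $H$, then $C^1_{\mathrm c}(I^r,E)\subset H$.
   Context: $I^r=[-r,0]$ for $r<\infty$ and $I^\infty=(-\infty,0]$; $\mathbb{R}_+=[0,\infty)$. $\mathrm{Map}(I,E)$ is the linear space of all maps $I\to E$; $\boldsymbol 0$ is the zero map. A history space is a linear subspace $H\subset\mathrm{Map}(I,E)$ with a topology for which the linear operations are continuous. $\mathbb{R}_++I=\{t+\theta:t\ge0,\theta\in I\}$, and for $\gamma\colon\mathbb{R}_++I\to E$ and $t\ge0$, $I_t\gamma\in\mathrm{Map}(I,E)$ is $I_t\gamma(\theta)=\gamma(t+\theta)$. A $C^1$-prolongation $\gamma\colon\mathbb{R}_++I\to E$ of $\boldsymbol 0$ is a map with $\gamma(\theta)=0$ for $\theta\in I$ and $\gamma|_{\mathbb{R}_+}$ of class $C^1$ (one-sided derivative at $0$); it is "with $0$-derivative" if the right derivative $\gamma'(0)$ is $0$. "$\boldsymbol 0$ is closed under $C^1$-prolongations with $0$-derivative in $H$" means: $I_t\gamma\in H$ for all $t\ge0$ and every $C^1$-prolongation $\gamma\colon\mathbb{R}_++I\to E$ of $\boldsymbol 0$ with $0$-derivative. $C^1_{\mathrm c}(I,E)$ is the set of $C^1$ maps $I\to E$ with compact support, where $\mathrm{supp}(f)$ is the closure of $\{t:f(t)\ne0\}$ (so it equals $C^1(I,E)$ if $I$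 is compact; on $I^0=\{0\}$ every map counts as $C^1$). *)

theory Defs
  imports "HOL-Analysis.Analysis"
begin

definition hist_interval :: "ereal \<Rightarrow> real set" where
  "hist_interval r = {\<theta>. - r \<le> ereal \<theta> \<and> \<theta> \<le> 0}"

text \<open>
  A map \<open>I \<rightarrow> E\<close> is represented by the unique extensional function \<open>real \<Rightarrow> E\<close> that
  agrees with it on \<open>I\<close> (and is \<open>undefined\<close> off \<open>I\<close>), so that equality of maps is
  equality in HOL. Hence the pointwise linear operations must be followed by
  \<open>restrict\<close>.
\<close>

definition Maps :: "real set \<Rightarrow> (real \<Rightarrow> 'a) set" where
  "Maps I = I \<rightarrow>\<^sub>E UNIV"

definition map_zero :: "real set \<Rightarrow> real \<Rightarrow> 'a::real_vector" where
  "map_zero I = (\<lambda>\<theta>\<in>I. 0)"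

definition map_add :: "real set \<Rightarrow> (real \<Rightarrow> 'a::real_vector) \<Rightarrow> (real \<Rightarrow> 'a) \<Rightarrow> real \<Rightarrow> 'a" where
  "map_add I f g = (\<lambda>\<theta>\<in>I. f \<theta> + g \<theta>)"

definition map_scale :: "real set \<Rightarrow> real \<Rightarrow> (real \<Rightarrow> 'a::real_vector) \<Rightarrow> real \<Rightarrow> 'a" where
  "map_scale I c f = (\<lambda>\<theta>\<in>I. c *\<^sub>R f \<theta>)"

text \<open>The topology \<open>T\<close> is not required to be Hausdorff.\<close>

definition history_space ::
    "real set \<Rightarrow> (real \<Rightarrow> 'a::real_vector) set \<Rightarrow> (real \<Rightarrow> 'a) topology \<Rightarrow> bool" where
  "history_space I H T \<longleftrightarrow>
     H \<subseteq> Maps I \<and>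
     map_zero I \<in> H \<and>
     (\<forall>f\<in>H. \<forall>g\<in>H. map_add I f g \<in> H) \<and>
     (\<forall>c. \<forall>f\<in>H. map_scale I c f \<in> H) \<and>
     topspace T = H \<and>
     continuous_map (prod_topology T T) T (\<lambda>(f, g). map_add I f g) \<and>
     continuous_map (prod_topology euclideanreal T) T (\<lambda>(c, f). map_scale I c f)"

definition prolong_domain :: "real set \<Rightarrow> real set" where
  "prolong_domain I = {t + \<theta> |t \<theta>. 0 \<le> t \<and> \<theta> \<in> I}"

definition history :: "real set \<Rightarrow> real \<Rightarrow> (real \<Rightarrow> 'a) \<Rightarrow> real \<Rightarrow> 'a" where
  "history I t \<gamma> = (\<lambda>\<theta>\<in>I. \<gamma> (t + \<theta>))"

text \<open>
  Derivatives are taken within \<open>S\<close>, hence are one-sided at the endpoints of an interval.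
  On a singleton the filter \<open>at x within {x}\<close> is trivial, so there every map is of
  class \<open>C\<^sup>1\<close>.
\<close>

definition C1_on :: "real set \<Rightarrow> (real \<Rightarrow> 'a::real_normed_vector) \<Rightarrow> bool" where
  "C1_on S f \<longleftrightarrow>
     (\<exists>f'. (\<forall>x\<in>S. (f has_vector_derivative f' x) (at x within S)) \<and> continuous_on S f')"

definition C1_prolongation_of_zero ::
    "real set \<Rightarrow> (real \<Rightarrow> 'a::real_normed_vector) \<Rightarrow> bool" where
  "C1_prolongation_of_zero I \<gamma> \<longleftrightarrow>
     \<gamma> \<in> Maps (prolong_domain I) \<and> (\<forall>\<theta>\<in>I. \<gamma> \<theta> = 0) \<and> C1_on {0..} \<gamma>"

definition zero_closed_under_C1_prolongations_0deriv ::
    "real set \<Rightarrow> (real \<Rightarrow> 'a::real_normed_vector) set \<Rightarrow> bool" where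
  "zero_closed_under_C1_prolongations_0deriv I H \<longleftrightarrow>
     (\<forall>\<gamma>. C1_prolongation_of_zero I \<gamma> \<and> (\<gamma> has_vector_derivative 0) (at_right 0) \<longrightarrow>
        (\<forall>t\<ge>0. history I t \<gamma> \<in> H))"

text \<open>
  The closure of the support is taken in \<open>real\<close>; for closed \<open>I\<close>, in particular for
  history intervals, this is the closure in \<open>I\<close>.
\<close>

definition C1_compact_support :: "real set \<Rightarrow> (real \<Rightarrow> 'a::real_normed_vector) set" where
  "C1_compact_support I = {f \<in> Maps I. C1_on I f \<and> compact (closure (support_on I f))}"

end

theory Submission
  imports Defs
begin

text \<open>
  Every \<open>C\<^sup>1\<close> map \<open>f\<close> with compact support is itself a history of a single prolongation of
  zero. Choose \<open>R > 0\<close> such that \<open>f\<close> vanishes on the part of \<open>I\<close> below \<open>-R\<close>, and delay \<open>f\<close> by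
  \<open>t = R + 1\<close>: the shifted map \<open>s \<mapsto> f (s - t)\<close> can then be nonzero only for
  \<open>1 \<le> s \<le> t\<close>, and the unit interval \<open>[0, 1]\<close> is free for a smooth start from zero. Extend
  \<open>f\<close> to a \<open>C\<^sup>1\<close> map \<open>F\<close> on \<open>[-t, \<infinity>)\<close> (\<open>C1_on_extension_atLeast\<close>) and let \<open>\<phi>\<close> be a \<open>C\<^sup>1\<close>
  function with \<open>\<phi> 0 = \<phi>' 0 = 0\<close> and \<open>\<phi> = 1\<close> on \<open>[1, \<infinity>)\<close> (\<open>C1_cutoff\<close>). Then
  \<open>\<gamma> s = \<phi> s *\<^sub>R F (s - t)\<close> for \<open>s > 0\<close>, continued by zero, is a \<open>C\<^sup>1\<close>-prolongation of zero
  with derivative zero at \<open>0\<close>.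

  Its history at time \<open>t\<close> is \<open>f\<close>. Where \<open>t + \<theta> \<ge> 1\<close> the cutoff is \<open>1\<close>. Where
  \<open>t + \<theta> < 1\<close>, that is \<open>\<theta> < -R\<close>, both sides vanish, because there \<open>F\<close> agrees with
  \<open>f = 0\<close> or \<open>\<gamma>\<close> has not started. Bounded and unbounded \<open>I\<close> are
  treated alike: boundedness of the support gives \<open>R\<close> in both cases.
\<close>

lemma antiderivative_on_atLeast:
  fixes g :: "real \<Rightarrow> 'a::banach"
  assumes "continuous_on {m..} g" and "x \<ge> m"
  shows "((\<lambda>u. integral {m..u} g) has_vector_derivative g x) (at x within {m..})"
proof -
  have "continuous_on {m..x + 1} g"
    using assms(1) by (rule continuous_on_subset) auto
  then have "((\<lambda>u. integral {m..u} g) has_vector_derivative g x) (at x within {m..x + 1})"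
    using assms(2) by (intro integral_has_vector_derivative) auto
  moreover have "at x within {m..x + 1} = at x within {m..}"
    by (rule at_within_nhd[where S = "{..<x + 1}"]) auto
  ultimately show ?thesis
    by simp
qed

text \<open>
  The extension integrates the derivative of \<open>f\<close>, continued from \<open>I\<close> by its values at the
  end points, i.e. composed with the nearest-point projection onto \<open>I\<close>. In this form nothing
  has to be glued at the end points, and the case that \<open>I\<close> is a single point, where the
  derivative of \<open>f\<close> is arbitrary, is included. The domain is a half-line so that a single
  integral with fixed lower limit defines the extension.
\<close>

lemma C1_on_extension_atLeast:
  fixes f :: "real \<Rightarrow> 'a::banach"
  assumes f: "C1_on I f" and I: "closed I" "convex I" "a \<in> I" and "m \<le> a"
  obtains F where "C1_on {m..} F" "\<And>x. x \<in> I \<Longrightarrow> m \<le> x \<Longrightarrow> F x = f x"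
proof -
  from f obtain f' where
    f': "\<And>x. x \<in> I \<Longrightarrow> (f has_vector_derivative f' x) (at x within I)"
    and cont: "continuous_on I f'"
    unfolding C1_on_def by blast
  define g where "g = f' \<circ> closest_point I"
  define F where "F x = f a - integral {m..a} g + integral {m..x} g" for x
  have "I \<noteq> {}"
    using I by auto
  then have g: "continuous_on {m..} g"
    unfolding g_def using I cont
    by (intro continuous_on_compose continuous_on_closest_point)
       (auto elim!: continuous_on_subset intro: closest_point_in_set)
  have F': "(F has_vector_derivative g x) (at x within {m..})" if "x \<ge> m" for x
    unfolding F_def[abs_def] using antiderivative_on_atLeast[OF g that]
    by (auto intro!: derivative_eq_intros)
  have "F x = f x" if x: "x \<in> I" "m \<le> x" for x
  proof -
    \<comment> \<open>\<open>F\<close> and \<open>f\<close> agree at \<open>a\<close> and have the same derivative on this convex set.\<close>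
    let ?J = "I \<inter> {m..}"
    have "((\<lambda>u. F u - f u) has_vector_derivative 0) (at u within ?J)" if "u \<in> ?J" for u
    proof -
      have "g u = f' u"
        using that I by (simp add: g_def closest_point_self)
      moreover have "(F has_vector_derivative g u) (at u within ?J)"
        using that by (intro has_vector_derivative_within_subset[OF F']) auto
      moreover have "(f has_vector_derivative f' u) (at u within ?J)"
        using that by (intro has_vector_derivative_within_subset[OF f']) auto
      ultimately show ?thesis
        using has_vector_derivative_diff[of F "g u" "at u within ?J" f "f' u"] by simp
    qed
    moreover have "convex ?J"
      using I by (simp add: convex_Int)
    ultimately obtain c where "\<And>u. u \<in> ?J \<Longrightarrow> F u - f u = c"
      using has_vector_derivative_zero_constant[of ?J "\<lambda>u. F u - f u"] by blast
    then have "F x - f x = F a - f a"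
      using x I \<open>m \<le> a\<close> by auto
    then show ?thesis
      by (simp add: F_def)
  qed
  moreover have "C1_on {m..} F"
    unfolding C1_on_def using F' g by auto
  ultimately show thesis
    using that by blast
qed

lemma has_vector_derivative_square_pos_part:
  "((\<lambda>x::real. (max 0 x)\<^sup>2) has_vector_derivative 2 * max 0 x) (at x)"
proof (cases x "0::real" rule: linorder_cases)
  case less
  have "((\<lambda>x::real. 0) has_vector_derivative 2 * max 0 x) (at x)"
    using less by (auto intro!: derivative_eq_intros)
  then show ?thesis
    by (rule has_vector_derivative_transform_within_open[where S = "{..<0}"]) (use less in auto)
next
  case equal
  have "((\<lambda>h::real. (max 0 h)\<^sup>2 / h) \<longlongrightarrow> 0) (at 0)"
  proof (rule Lim_null_comparison)
    show "\<forall>\<^sub>F h in at (0::real). norm ((max 0 h)\<^sup>2 / h) \<le> \<bar>h\<bar>"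
      by (rule always_eventually) (auto simp: max_def power2_eq_square)
    show "((\<lambda>h::real. \<bar>h\<bar>) \<longlongrightarrow> 0) (at 0)"
      using tendsto_rabs_zero[OF tendsto_ident_at] .
  qed
  then have "((\<lambda>x::real. (max 0 x)\<^sup>2) has_field_derivative 0) (at 0)"
    by (simp add: DERIV_def)
  then show ?thesis
    using equal by (simp add: has_real_derivative_iff_has_vector_derivative)
next
  case greater
  have "((\<lambda>x::real. x\<^sup>2) has_field_derivative 2 * max 0 x) (at x)"
    using greater by (auto intro!: derivative_eq_intros)
  then have "((\<lambda>x::real. x\<^sup>2) has_vector_derivative 2 * max 0 x) (at x)"
    by (simp add: has_real_derivative_iff_has_vector_derivative)
  then show ?thesis
    by (rule has_vector_derivative_transform_within_open[where S = "{0<..}"]) (use greater in auto)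
qed

text \<open>
  With \<open>q x = (max 0 x)\<^sup>2\<close>, which is \<open>C\<^sup>1\<close> and vanishes for \<open>x \<le> 0\<close>, the cutoff is
  \<open>1 - q (1 - s\<^sup>2)\<close>: the inner square makes the derivative vanish at \<open>s = 0\<close>, and \<open>q\<close> switches
  off at \<open>s = 1\<close> without a corner.
\<close>

lemma C1_cutoff:
  obtains \<phi> \<phi>' :: "real \<Rightarrow> real"
  where "\<And>s. (\<phi> has_field_derivative \<phi>' s) (at s)" "continuous_on UNIV \<phi>'"
    "\<phi> 0 = 0" "\<phi>' 0 = 0" "\<And>s. 1 \<le> s \<Longrightarrow> \<phi> s = 1"
proof -
  let ?\<phi> = "\<lambda>s::real. 1 - (max 0 (1 - s\<^sup>2))\<^sup>2"
  let ?\<phi>' = "\<lambda>s::real. 4 * s * max 0 (1 - s\<^sup>2)"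
  have deriv: "(?\<phi> has_field_derivative ?\<phi>' s) (at s)" for s
  proof -
    have "((\<lambda>x::real. (max 0 x)\<^sup>2) has_field_derivative 2 * max 0 (1 - s\<^sup>2)) (at (1 - s\<^sup>2))"
      using has_vector_derivative_square_pos_part
      by (simp add: has_real_derivative_iff_has_vector_derivative)
    moreover have "((\<lambda>s::real. 1 - s\<^sup>2) has_field_derivative - (2 * s)) (at s)"
      by (auto intro!: derivative_eq_intros)
    ultimately have "((\<lambda>s. (max 0 (1 - s\<^sup>2))\<^sup>2) has_field_derivative
        2 * max 0 (1 - s\<^sup>2) * - (2 * s)) (at s)"
      by (rule DERIV_chain2)
    from DERIV_diff[OF DERIV_const this, of 1] show ?thesis
      by (rule DERIV_cong) simp
  qed
  have cont: "continuous_on UNIV ?\<phi>'"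
    by (intro continuous_intros)
  have one: "?\<phi> s = 1" if "1 \<le> s" for s
  proof -
    have "max 0 (1 - s\<^sup>2) = 0"
      using that by simp
    then show ?thesis
      by simp
  qed
  show thesis
    by (rule that[of ?\<phi> ?\<phi>', OF deriv cont _ _ one]) simp_all
qed

text \<open>
  The extension \<open>F\<close>, delayed by \<open>t = R + 1\<close> and multiplied by the cutoff, is a prolongation of
  zero whose history at time \<open>t\<close> is \<open>f\<close>; the extra unit of delay is where the cutoff rises.
\<close>

lemma C1_compact_support_in_prolongation_closed:
  fixes f :: "real \<Rightarrow> 'a::banach"
  assumes I: "closed I" "convex I" "0 \<in> I" "I \<subseteq> {..0}"
    and H: "zero_closed_under_C1_prolongations_0deriv I H"
    and f: "f \<in> C1_compact_support I"
  shows "f \<in> H"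
proof -
  have "bounded (support_on I f)"
    using f compact_imp_bounded bounded_subset[OF _ closure_subset]
    unfolding C1_compact_support_def by auto
  then obtain R where "0 < R" and "\<And>x. x \<in> support_on I f \<Longrightarrow> \<bar>x\<bar> \<le> R"
    unfolding bounded_pos by auto
  then have f0: "f x = 0" if "x \<in> I" "x < - R" for x
    using that by (fastforce simp: in_support_on)
  define t where "t = R + 1"
  have "t > 0"
    using \<open>0 < R\<close> by (simp add: t_def)
  obtain F where F: "C1_on {- t..} F" "\<And>x. x \<in> I \<Longrightarrow> - t \<le> x \<Longrightarrow> F x = f x"
    using C1_on_extension_atLeast[of I f 0 "- t"] f I \<open>t > 0\<close>
    unfolding C1_compact_support_def by auto
  from F(1) obtain F' where
    F': "\<And>x. x \<ge> - t \<Longrightarrow> (F has_vector_derivative F' x) (at x within {- t..})"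
    and cont_F': "continuous_on {- t..} F'"
    unfolding C1_on_def by (metis atLeast_iff)
  obtain \<phi> \<phi>' :: "real \<Rightarrow> real" where \<phi>:
    "\<And>s. (\<phi> has_field_derivative \<phi>' s) (at s)" "continuous_on UNIV \<phi>'"
    "\<phi> 0 = 0" "\<phi>' 0 = 0" "\<And>s. 1 \<le> s \<Longrightarrow> \<phi> s = 1"
    using C1_cutoff by blast
  define \<gamma> where
    "\<gamma> = (\<lambda>s\<in>prolong_domain I. if s \<le> 0 then 0 else \<phi> s *\<^sub>R F (s - t))"
  \<comment> \<open>The derivative of \<open>\<gamma>\<close> on the half-line of nonnegative reals; it vanishes at \<open>0\<close> whatever \<open>F\<close> is.\<close>
  define \<gamma>' where "\<gamma>' s = \<phi> s *\<^sub>R F' (s - t) + \<phi>' s *\<^sub>R F (s - t)" for s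
  have dom: "u + \<theta> \<in> prolong_domain I" if "0 \<le> u" "\<theta> \<in> I" for u \<theta>
    using that unfolding prolong_domain_def by auto
  have dom_I: "I \<subseteq> prolong_domain I" and dom_nonneg: "{0..} \<subseteq> prolong_domain I"
    using dom[of 0] dom[of _ 0] \<open>0 \<in> I\<close> by auto
  have \<gamma>_deriv: "(\<gamma> has_vector_derivative \<gamma>' s) (at s within {0..})" if "0 \<le> s" for s
  proof -
    have "((\<lambda>u. F (u - t)) has_vector_derivative F' (s - t)) (at s within {0..})"
    proof -
      have "((\<lambda>u. u - t) has_vector_derivative 1) (at s within {0..})"
        by (auto intro!: derivative_eq_intros)
      moreover have "(F has_vector_derivative F' (s - t)) (at (s - t) within (\<lambda>u. u - t) ` {0..})"
        using that by (intro has_vector_derivative_within_subset[OF F']) auto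
      ultimately show ?thesis
        using vector_diff_chain_within[of "\<lambda>u. u - t" 1 s "{0..}" F "F' (s - t)"]
        by (simp add: o_def)
    qed
    moreover have "(\<phi> has_field_derivative \<phi>' s) (at s within {0..})"
      using \<phi>(1) by (rule has_field_derivative_at_within)
    ultimately have "((\<lambda>u. \<phi> u *\<^sub>R F (u - t)) has_vector_derivative \<gamma>' s) (at s within {0..})"
      unfolding \<gamma>'_def by (intro has_vector_derivative_scaleR)
    then show ?thesis
      by (rule has_vector_derivative_transform[rotated 2])
         (use that dom_nonneg \<phi>(3) in \<open>auto simp: \<gamma>_def\<close>)
  qed
  have "continuous_on {0..} \<gamma>'"
  proof -
    have shift: "continuous_on {0..} (\<lambda>s. g (s - t))" if "continuous_on {- t..} g"
      for g :: "real \<Rightarrow> 'a"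
      by (rule continuous_on_compose2[OF that]) (auto intro!: continuous_intros)
    have "continuous_on {- t..} F"
      using F' by (intro continuous_on_vector_derivative[of _ F F']) auto
    moreover have "continuous_on {0..} \<phi>'"
      using \<phi>(2) by (rule continuous_on_subset) simp
    moreover have "continuous_on {0..} \<phi>"
      using \<phi>(1) by (intro DERIV_continuous_on) (auto intro: has_field_derivative_at_within)
    ultimately show ?thesis
      unfolding \<gamma>'_def using cont_F' by (intro continuous_on_add continuous_on_scaleR shift)
  qed
  then have "C1_on {0..} \<gamma>"
    unfolding C1_on_def using \<gamma>_deriv by auto
  moreover have "\<gamma> \<in> Maps (prolong_domain I)"
    by (auto simp: \<gamma>_def Maps_def)
  moreover have "\<gamma> \<theta> = 0" if "\<theta> \<in> I" for \<theta>
    using that I dom_I by (auto simp: \<gamma>_def)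
  ultimately have "C1_prolongation_of_zero I \<gamma>"
    unfolding C1_prolongation_of_zero_def by auto
  moreover have "(\<gamma> has_vector_derivative 0) (at_right 0)"
  proof -
    have "(\<gamma> has_vector_derivative \<gamma>' 0) (at_right 0)"
      by (rule has_vector_derivative_within_subset[OF \<gamma>_deriv]) auto
    then show ?thesis
      using \<phi>(3,4) by (simp add: \<gamma>'_def)
  qed
  ultimately have "history I t \<gamma> \<in> H"
    using H \<open>t > 0\<close> unfolding zero_closed_under_C1_prolongations_0deriv_def
    by (meson less_imp_le)
  moreover have "history I t \<gamma> = f"
  proof
    fix \<theta>
    consider "\<theta> \<notin> I" | "\<theta> \<in> I" "1 \<le> t + \<theta>" | "\<theta> \<in> I" "t + \<theta> < 1"
      by linarith
    then show "history I t \<gamma> \<theta> = f \<theta>"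
    proof cases
      case 1
      then show ?thesis
        using f by (simp add: history_def C1_compact_support_def Maps_def PiE_def extensional_def)
    next
      case 2
      then show ?thesis
        using dom[of t \<theta>] F(2)[of \<theta>] \<phi>(5) \<open>t > 0\<close> by (simp add: history_def \<gamma>_def)
    next
      case 3
      then have "f \<theta> = 0"
        using f0 by (simp add: t_def)
      \<comment> \<open>If \<open>t + \<theta> \<le> 0\<close>, then \<open>\<gamma>\<close> is zero by definition; otherwise \<open>-t \<le> \<theta>\<close>, so \<open>F \<theta> = f \<theta> = 0\<close>.\<close>
      with 3 show ?thesis
        using dom[of t \<theta>] F(2)[of \<theta>] \<open>t > 0\<close> by (auto simp: history_def \<gamma>_def)
    qed
  qed
  ultimately show ?thesis
    by simp
qed

lemma hist_interval_closed_convex: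
  shows "closed (hist_interval r)" and "convex (hist_interval r)"
proof -
  have "hist_interval r = (if r = \<infinity> then {..0} else if r = -\<infinity> then {} else {- real_of_ereal r..0})"
    by (cases r) (auto simp: hist_interval_def)
  then show "closed (hist_interval r)" and "convex (hist_interval r)"
    by (auto split: if_splits)
qed

theorem proposition3p2:
  fixes r :: ereal
    and H :: "(real \<Rightarrow> 'a::banach) set"
    and T :: "(real \<Rightarrow> 'a) topology"
  assumes "0 \<le> r"
    and "history_space (hist_interval r) H T"
    and "zero_closed_under_C1_prolongations_0deriv (hist_interval r) H"
  shows "C1_compact_support (hist_interval r) \<subseteq> H"
proof -
  have "0 \<in> hist_interval r" "hist_interval r \<subseteq> {..0}"
    using assms(1) by (auto simp: hist_interval_def zero_ereal_def[symmetric])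
  then show ?thesis
    using C1_compact_support_in_prolongation_closed[OF hist_interval_closed_convex] assms(3)
    by (meson subsetI)
qed

end
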